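(* Let $X$ be a first-countable almost regular topological space. If player two has a winning strategy in the game $G^{\omega_1}_1(\mathcal{O}_X,\mathcal{D}_X)$, then $|X|\le 2^{\aleph_0}$.
   Context: For an ordinal $\alpha$ and collections of sets $\mathcal{A},\mathcal{B}$, $G^\alpha_1(\mathcal{A},\mathcal{B})$ denotes the two-player game of length $\alpha$ in which, at inning $\beta<\alpha$, player one chooses $\mathcal{U}_\beta\in\mathcal{A}$ and player two responds with an element $V_\beta\in\mathcal{U}_\beta$. Player two wins if and only if $\{V_\beta:\beta<\alpha\}\in\mathcal{B}$. For a topological space $X$: $\mathcal{O}_X$ is the set of all open covers of $X$, and $\mathcal{D}_X$ is the collection of all families $\mathcal{U}$ of open subsets of $X$ such that $\bigcup\mathcal{U}$ is dense in $X$. A space $X$ is almost regular if for every non-empty open set $U\subset X$ there is a non-empty open set $V$ such that $\overline{V}\subset U$.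
   Formalization: The space X is additionally assumed to be Hausdorff; without this the claim fails, e.g. for an indiscrete space of cardinality greater than 2^{\aleph_0}, where player two wins by always answering X. *)

theory Defs
  imports "HOL-Analysis.Analysis"
begin

unbundle cardinal_syntax

text \<open>Ordinals are represented by well-order relations: the innings of a game of length \<open>r\<close> are
  the elements of \<open>Field r\<close>, ordered by \<open>r\<close>.  The first uncountable ordinal is the initial ordinal
  of the cardinal successor of \<open>natLeq\<close>.\<close>

definition omega1 :: "nat set rel" where
  "omega1 = cardSuc natLeq"

text \<open>A strategy \<open>\<sigma>\<close> of player two answers, at inning \<open>\<beta>\<close>, the sequence of moves that player one
  has made at the innings \<open>\<gamma> \<le> \<beta>\<close>; \<open>restrict\<close> erases all later moves.  Player two's own earlier
  moves are determined by \<open>\<sigma>\<close> and that sequence.\<close>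

definition response :: "'i rel \<Rightarrow> ('i \<Rightarrow> ('i \<Rightarrow> 'b set) \<Rightarrow> 'b) \<Rightarrow> ('i \<Rightarrow> 'b set) \<Rightarrow> 'i \<Rightarrow> 'b" where
  "response r \<sigma> U \<beta> = \<sigma> \<beta> (restrict U (under r \<beta>))"

definition strategy_two ::
    "'i rel \<Rightarrow> 'b set set \<Rightarrow> ('i \<Rightarrow> ('i \<Rightarrow> 'b set) \<Rightarrow> 'b) \<Rightarrow> bool" where
  "strategy_two r \<A> \<sigma> \<longleftrightarrow>
     (\<forall>\<beta>\<in>Field r. \<forall>U. (\<forall>\<gamma>\<in>under r \<beta>. U \<gamma> \<in> \<A>) \<longrightarrow> response r \<sigma> U \<beta> \<in> U \<beta>)"

definition winning_strategy_two ::
    "'i rel \<Rightarrow> 'b set set \<Rightarrow> 'b set set \<Rightarrow> ('i \<Rightarrow> ('i \<Rightarrow> 'b set) \<Rightarrow> 'b) \<Rightarrow> bool" where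
  "winning_strategy_two r \<A> \<B> \<sigma> \<longleftrightarrow>
     strategy_two r \<A> \<sigma> \<and>
     (\<forall>U. (\<forall>\<beta>\<in>Field r. U \<beta> \<in> \<A>) \<longrightarrow> {response r \<sigma> U \<beta> |\<beta>. \<beta> \<in> Field r} \<in> \<B>)"

definition two_wins_G1 :: "'i rel \<Rightarrow> 'b set set \<Rightarrow> 'b set set \<Rightarrow> bool" where
  "two_wins_G1 r \<A> \<B> \<longleftrightarrow> (\<exists>\<sigma>. winning_strategy_two r \<A> \<B> \<sigma>)"

definition open_covers :: "'a topology \<Rightarrow> 'a set set set" where
  "open_covers X = {\<U>. (\<forall>U\<in>\<U>. openin X U) \<and> \<Union>\<U> = topspace X}"

definition dense_open_families :: "'a topology \<Rightarrow> 'a set set set" where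
  "dense_open_families X =
     {\<U>. (\<forall>U\<in>\<U>. openin X U) \<and> X closure_of (\<Union>\<U>) = topspace X}"

text \<open>This notion carries no separation axiom: indiscrete spaces are almost regular.\<close>

definition almost_regular_space :: "'a topology \<Rightarrow> bool" where
  "almost_regular_space X \<longleftrightarrow>
     (\<forall>U. openin X U \<and> U \<noteq> {} \<longrightarrow> (\<exists>V. openin X V \<and> V \<noteq> {} \<and> X closure_of V \<subseteq> U))"

end

theory Submission
  imports Defs
begin

text \<open>Fix a winning strategy of player two. At every position of the game there is a point all of
  whose open neighbourhoods occur as answers of the strategy: otherwise each point would have an
  open neighbourhood that is never an answer, and player one could offer the cover that consists of
  these neighbourhoods. By first countability, countably many covers suffice to make player two
  answer with each member of a neighbourhood base of that point. If player one restricts himself to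
  these covers, the positions form a tree of height \<open>\<omega>\<^sub>1\<close> in which every node has countably many
  successors. A node at a level below \<open>\<omega>\<^sub>1\<close> is given by a countable sequence of natural numbers,
  so each of the \<open>\<omega>\<^sub>1\<close> levels has at most \<open>2\<^sup>\<omega>\<close> nodes (\<open>card_tree_level\<close>), and the set \<open>D\<close> of
  the points attached to all nodes has at most \<open>2\<^sup>\<omega>\<close> elements.

  The set \<open>D\<close> is dense. Otherwise almost regularity yields a non-empty open set \<open>V\<close> whose closure
  misses \<open>D\<close>. Every point of \<open>D\<close> then has a basic neighbourhood disjoint from \<open>V\<close>, so player one
  can walk through the tree in such a way that all answers of player two miss \<open>V\<close>, and the
  strategy loses. In a first-countable Hausdorff space the closure of a set of size at most
  \<open>2\<^sup>\<omega>\<close> has size at most \<open>2\<^sup>\<omega>\<close>, because a point is determined by a sequence that converges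
  to it (\<open>card_closure_of\<close>).\<close>

section \<open>Cardinal arithmetic\<close>

lemma card_sequences_le_continuum:
  assumes "|D| \<le>o ctwo ^c natLeq"
  shows "|Func (UNIV :: nat set) D| \<le>o ctwo ^c natLeq"
proof -
  have "|Func (UNIV :: nat set) D| =o |D| ^c natLeq"
    by (simp add: cexp_def Field_natLeq Field_card_of card_of_refl)
  also have "|D| ^c natLeq \<le>o (ctwo ^c natLeq) ^c natLeq"
    by (rule cexp_mono1[OF assms natLeq_Card_order])
  also have "(ctwo ^c natLeq) ^c natLeq =o ctwo ^c natLeq"
    by (intro cexp_cprod_ordLeq Card_order_ctwo natLeq_Cinfinite Cinfinite_Cnotzero
        ordLeq_refl natLeq_Card_order)
  finally show ?thesis .
qed

lemma natLeq_less_continuum: "natLeq <o ctwo ^c natLeq"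
  by (simp add: ordLess_ctwo_cexp natLeq_Card_order)

lemma card_functions_nat_le_continuum: "|UNIV :: (nat \<Rightarrow> nat) set| \<le>o ctwo ^c natLeq"
proof -
  have "|UNIV :: nat set| \<le>o ctwo ^c natLeq"
    using card_of_nat natLeq_less_continuum ordIso_ordLeq_trans ordLess_imp_ordLeq by blast
  from card_sequences_le_continuum[OF this] show ?thesis
    by (simp add: Func_def)
qed

lemma Card_order_omega1: "Card_order omega1"
  by (simp add: omega1_def cardSuc_Card_order natLeq_Card_order)

lemma card_Field_omega1: "|Field omega1| \<le>o ctwo ^c natLeq"
proof -
  have "omega1 \<le>o ctwo ^c natLeq"
    unfolding omega1_def
    by (intro cardSuc_least natLeq_Card_order Card_order_cexp natLeq_less_continuum)
  with card_of_Field_ordIso[OF Card_order_omega1] show ?thesis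
    by (rule ordIso_ordLeq_trans)
qed

lemma countable_underS_omega1:
  assumes "\<beta> \<in> Field omega1"
  shows "countable (underS omega1 \<beta>)"
proof -
  have "|underS omega1 \<beta>| <o cardSuc natLeq"
    using card_of_underS[OF Card_order_omega1 assms] by (simp add: omega1_def)
  then have "|underS omega1 \<beta>| \<le>o natLeq"
    by (simp add: cardSuc_ordLeq_ordLess natLeq_Card_order card_of_Card_order)
  then have "|underS omega1 \<beta>| \<le>o |UNIV :: nat set|"
    using card_of_nat ordIso_symmetric ordLeq_ordIso_trans by blast
  then show ?thesis
    unfolding countable_def by (simp add: card_of_ordLeq[symmetric])
qed

section \<open>Closures in first-countable Hausdorff spaces\<close>

lemma first_countable_decseq_base:
  assumes "first_countable X"
  obtains B :: "'a \<Rightarrow> nat \<Rightarrow> 'a set"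
  where "\<And>x n. x \<in> topspace X \<Longrightarrow> openin X (B x n)"
    and "\<And>x n. x \<in> topspace X \<Longrightarrow> x \<in> B x n"
    and "\<And>x. x \<in> topspace X \<Longrightarrow> decseq (B x)"
    and "\<And>x U. x \<in> topspace X \<Longrightarrow> openin X U \<Longrightarrow> x \<in> U \<Longrightarrow> \<exists>n. B x n \<subseteq> U"
proof -
  have "\<exists>b :: nat \<Rightarrow> 'a set. (\<forall>n. openin X (b n) \<and> x \<in> b n) \<and> decseq b
      \<and> (\<forall>U. openin X U \<and> x \<in> U \<longrightarrow> (\<exists>n. b n \<subseteq> U))"
    if x: "x \<in> topspace X" for x
  proof -
    obtain \<B> where "countable \<B>" and op: "\<And>V. V \<in> \<B> \<Longrightarrow> openin X V"
      and base: "\<And>U. openin X U \<Longrightarrow> x \<in> U \<Longrightarrow> \<exists>V\<in>\<B>. x \<in> V \<and> V \<subseteq> U"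
      using assms x unfolding first_countable_def by metis
    define \<C> where "\<C> = {V \<in> \<B>. x \<in> V}"
    have "\<C> \<noteq> {}"
      using base[OF openin_topspace x] by (auto simp: \<C>_def)
    moreover have "countable \<C>"
      using \<open>countable \<B>\<close> by (simp add: \<C>_def)
    ultimately obtain e :: "nat \<Rightarrow> 'a set" where e: "\<C> = range e"
      by (metis uncountable_def)
    have e_op: "openin X (e i)" "x \<in> e i" for i
      using e op by (auto simp: \<C>_def)
    define b where "b n = (\<Inter>i\<le>n. e i)" for n
    have "openin X (b n)" "x \<in> b n" for n
      unfolding b_def using e_op by (auto intro!: openin_Inter)
    moreover have "decseq b"
      by (force simp: decseq_def b_def)
    moreover have "\<exists>n. b n \<subseteq> U" if "openin X U" "x \<in> U" for U
    proof -
      obtain V where "V \<in> \<C>" "V \<subseteq> U"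
        using base[OF \<open>openin X U\<close> \<open>x \<in> U\<close>] by (auto simp: \<C>_def)
      then obtain n where "e n \<subseteq> U"
        using e by auto
      then have "b n \<subseteq> U"
        by (auto simp: b_def)
      then show ?thesis ..
    qed
    ultimately show ?thesis
      by blast
  qed
  then show ?thesis
    using that by metis
qed

text \<open>Choosing a sequence in \<open>D\<close> that converges to \<open>y\<close> is an injective map from the closure to
  \<open>D\<^sup>\<omega>\<close>, since limits are unique.\<close>

lemma card_closure_of:
  assumes "Hausdorff_space X" and "first_countable X" and "|D| \<le>o ctwo ^c natLeq"
  shows "|X closure_of D| \<le>o ctwo ^c natLeq"
proof -
  obtain B :: "'a \<Rightarrow> nat \<Rightarrow> 'a set"
    where B_op: "\<And>x n. x \<in> topspace X \<Longrightarrow> openin X (B x n)"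
      and B_mem: "\<And>x n. x \<in> topspace X \<Longrightarrow> x \<in> B x n"
      and B_dec: "\<And>x. x \<in> topspace X \<Longrightarrow> decseq (B x)"
      and B_base: "\<And>x U. x \<in> topspace X \<Longrightarrow> openin X U \<Longrightarrow> x \<in> U \<Longrightarrow> \<exists>n. B x n \<subseteq> U"
    by (rule first_countable_decseq_base[OF assms(2)]) (rule that)
  have top: "y \<in> topspace X" if "y \<in> X closure_of D" for y
    using that by (simp add: in_closure_of)
  have "\<exists>d. d \<in> D \<and> d \<in> B y n" if "y \<in> X closure_of D" for y n
    using that B_op[of y n] B_mem[of y n] unfolding in_closure_of by blast
  then obtain s where s: "\<And>y n. y \<in> X closure_of D \<Longrightarrow> s y n \<in> D \<and> s y n \<in> B y n"
    by metis
  have "inj_on s (X closure_of D)"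
  proof (rule inj_onI, rule ccontr)
    fix y z
    assume y: "y \<in> X closure_of D" and z: "z \<in> X closure_of D" and eq: "s y = s z"
      and "y \<noteq> z"
    then obtain U V where UV: "openin X U" "openin X V" "y \<in> U" "z \<in> V" "disjnt U V"
      using assms(1) top[OF y] top[OF z] unfolding Hausdorff_space_def by metis
    obtain m n where m: "B y m \<subseteq> U" and n: "B z n \<subseteq> V"
      using B_base[OF top[OF y] UV(1,3)] B_base[OF top[OF z] UV(2,4)] by blast
    have "s y (max m n) \<in> B y m"
      using s[OF y, of "max m n"] decseqD[OF B_dec[OF top[OF y]], of m "max m n"] by auto
    moreover have "s z (max m n) \<in> B z n"
      using s[OF z, of "max m n"] decseqD[OF B_dec[OF top[OF z]], of n "max m n"] by auto
    ultimately show False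
      using m n eq UV(5) by (auto simp: disjnt_iff)
  qed
  moreover have "s ` (X closure_of D) \<subseteq> Func UNIV D"
    using s by (auto simp: Func_def)
  ultimately have "|X closure_of D| \<le>o |Func (UNIV :: nat set) D|"
    using card_of_ordLeq by blast
  then show ?thesis
    using card_sequences_le_continuum[OF assms(3)] ordLeq_transitive by blast
qed

section \<open>Countably branching trees of histories\<close>

text \<open>A map \<open>N\<close> offers, at inning \<open>\<gamma>\<close> and after the history \<open>p\<close>, the countably many moves
  \<open>N \<gamma> p n\<close>. The nodes at level \<open>\<beta>\<close> are the histories in which only offered moves were made;
  restricting them to the earlier innings makes them comparable as functions.\<close>

definition tree_level ::
    "'i rel \<Rightarrow> ('i \<Rightarrow> ('i \<Rightarrow> 'c) \<Rightarrow> nat \<Rightarrow> 'c) \<Rightarrow> 'i \<Rightarrow> ('i \<Rightarrow> 'c) set" where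
  "tree_level r N \<beta> =
     {restrict P (underS r \<beta>) |P.
        \<exists>f. \<forall>\<gamma>\<in>underS r \<beta>. P \<gamma> = N \<gamma> (restrict P (underS r \<gamma>)) (f \<gamma>)}"

text \<open>A history is determined by the sequence \<open>f\<close> of its choices, which here is a function from
  a countable set to the natural numbers.\<close>

lemma card_tree_level:
  assumes wo: "Well_order r" and "countable (underS r \<beta>)"
  shows "|tree_level r N \<beta>| \<le>o ctwo ^c natLeq"
proof -
  have wo_rel: "wo_rel r"
    using wo by (simp add: wo_rel_def)
  define S where "S = underS r \<beta>"
  have trans_S: "underS r \<gamma> \<subseteq> S" if "\<gamma> \<in> S" for \<gamma>
    using that underS_incr[OF wo_rel.TRANS[OF wo_rel] wo_rel.ANTISYM[OF wo_rel], of \<gamma> \<beta>] by (auto simp: S_def underS_def)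
  have "\<exists>f. \<forall>\<gamma>\<in>S. q \<gamma> = N \<gamma> (restrict q (underS r \<gamma>)) (f \<gamma>)" if "q \<in> tree_level r N \<beta>" for q
  proof -
    from that obtain P f where q: "q = restrict P S"
      and f: "\<forall>\<gamma>\<in>S. P \<gamma> = N \<gamma> (restrict P (underS r \<gamma>)) (f \<gamma>)"
      by (auto simp: tree_level_def S_def)
    have "restrict q (underS r \<gamma>) = restrict P (underS r \<gamma>)" if "\<gamma> \<in> S" for \<gamma>
      using trans_S[OF that] by (auto simp: q restrict_def fun_eq_iff)
    then show ?thesis
      using f q by (intro exI[of _ f]) simp
  qed
  then obtain F where F: "\<And>q \<gamma>. q \<in> tree_level r N \<beta> \<Longrightarrow> \<gamma> \<in> S
      \<Longrightarrow> q \<gamma> = N \<gamma> (restrict q (underS r \<gamma>)) (F q \<gamma>)"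
    by metis
  have determined: "p = q"
    if p: "p \<in> tree_level r N \<beta>" and q: "q \<in> tree_level r N \<beta>"
      and eq: "\<And>\<gamma>. \<gamma> \<in> S \<Longrightarrow> F p \<gamma> = F q \<gamma>" for p q
  proof -
    have "\<gamma> \<in> S \<longrightarrow> p \<gamma> = q \<gamma>" for \<gamma>
    proof (induction \<gamma> rule: wo_rel.well_order_induct[OF wo_rel])
      case (1 \<gamma>)
      show ?case
      proof
        assume \<gamma>: "\<gamma> \<in> S"
        have "restrict p (underS r \<gamma>) = restrict q (underS r \<gamma>)"
          using 1 trans_S[OF \<gamma>] by (auto simp: restrict_def underS_def fun_eq_iff)
        then show "p \<gamma> = q \<gamma>"
          using F[OF p \<gamma>] F[OF q \<gamma>] eq[OF \<gamma>] by simp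
      qed
    qed
    moreover have "p \<in> extensional S" "q \<in> extensional S"
      using p q by (auto simp: tree_level_def S_def)
    ultimately show ?thesis
      by (auto intro: extensionalityI)
  qed
  have "inj_on (\<lambda>q n. F q (from_nat_into S n)) (tree_level r N \<beta>)"
  proof (rule inj_onI)
    fix p q
    assume p: "p \<in> tree_level r N \<beta>" and q: "q \<in> tree_level r N \<beta>"
      and eq: "(\<lambda>n. F p (from_nat_into S n)) = (\<lambda>n. F q (from_nat_into S n))"
    have "F p \<gamma> = F q \<gamma>" if "\<gamma> \<in> S" for \<gamma>
    proof -
      obtain n where "from_nat_into S n = \<gamma>"
        using from_nat_into_surj[of S \<gamma>] assms(2) \<open>\<gamma> \<in> S\<close> unfolding S_def by blast
      then show ?thesis
        using fun_cong[OF eq, of n] by simp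
    qed
    then show "p = q"
      by (rule determined[OF p q])
  qed
  then have "|tree_level r N \<beta>| \<le>o |UNIV :: (nat \<Rightarrow> nat) set|"
    using card_of_ordLeq by blast
  then show ?thesis
    using card_functions_nat_le_continuum ordLeq_transitive by blast
qed

text \<open>Player one can follow any rule \<open>G\<close> that computes the next move from the history; this is
  well-founded recursion along \<open>r\<close>.\<close>

lemma history_recursion:
  assumes "Well_order r"
  obtains P where "\<And>\<beta>. P \<beta> = G \<beta> (restrict P (underS r \<beta>))"
proof -
  have wo_rel: "wo_rel r"
    using assms by (simp add: wo_rel_def)
  define H where "H = (\<lambda>P \<beta>. G \<beta> (restrict P (underS r \<beta>)))"
  have "restrict f (underS r x) = restrict g (underS r x)"
    if "\<forall>y\<in>underS r x. f y = g y" for f g :: "'a \<Rightarrow> 'b" and x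
    using that by (auto simp: restrict_def)
  then have "wo_rel.adm_wo r H"
    unfolding wo_rel.adm_wo_def[OF wo_rel] H_def by metis
  then have "wo_rel.worec r H \<beta> = G \<beta> (restrict (wo_rel.worec r H) (underS r \<beta>))" for \<beta>
    using wo_rel.worec_fixpoint[OF wo_rel, of H] by (metis H_def)
  then show ?thesis
    by (rule that)
qed

section \<open>Positions of the game\<close>

lemma response_cong:
  assumes "\<And>\<gamma>. \<gamma> \<in> under r \<beta> \<Longrightarrow> U \<gamma> = U' \<gamma>"
  shows "response r \<sigma> U \<beta> = response r \<sigma> U' \<beta>"
proof -
  have "restrict U (under r \<beta>) = restrict U' (under r \<beta>)"
    using assms by (simp add: restrict_def fun_eq_iff)
  then show ?thesis
    by (simp add: response_def)
qed

text \<open>If every point \<open>x\<close> had a neighbourhood \<open>W x\<close> that is never an answer after the history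
  \<open>p\<close>, then the answer to the cover consisting of all \<open>W x\<close> would be one of them. The same argument
  shows that the space is non-empty, as player two cannot answer the empty cover.\<close>

lemma exists_point_all_neighbourhoods_answered:
  assumes "strategy_two r (open_covers X) \<sigma>" and "\<beta> \<in> Field r"
    and hist: "\<And>\<gamma>. \<gamma> \<in> underS r \<beta> \<Longrightarrow> p \<gamma> \<in> open_covers X"
  obtains x where "x \<in> topspace X"
    and "\<And>W. openin X W \<Longrightarrow> x \<in> W
      \<Longrightarrow> \<exists>C\<in>open_covers X. response r \<sigma> (p(\<beta> := C)) \<beta> = W"
proof (rule ccontr)
  assume "\<not> thesis"
  then have "\<forall>x\<in>topspace X. \<exists>W. openin X W \<and> x \<in> W
      \<and> (\<forall>C\<in>open_covers X. response r \<sigma> (p(\<beta> := C)) \<beta> \<noteq> W)"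
    using that by metis
  then obtain W where W: "\<And>x. x \<in> topspace X \<Longrightarrow> openin X (W x) \<and> x \<in> W x
      \<and> (\<forall>C\<in>open_covers X. response r \<sigma> (p(\<beta> := C)) \<beta> \<noteq> W x)"
    by metis
  define C where "C = W ` topspace X"
  have "\<Union>C \<subseteq> topspace X"
    using W openin_subset unfolding C_def by blast
  moreover have "topspace X \<subseteq> \<Union>C"
    using W unfolding C_def by blast
  ultimately have C: "C \<in> open_covers X"
    using W by (auto simp: open_covers_def C_def)
  have "(p(\<beta> := C)) \<gamma> \<in> open_covers X" if "\<gamma> \<in> under r \<beta>" for \<gamma>
    using that hist C by (auto simp: under_def underS_def)
  then have "response r \<sigma> (p(\<beta> := C)) \<beta> \<in> (p(\<beta> := C)) \<beta>"
    using assms(1,2) unfolding strategy_two_def by blast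
  then show False
    using W C by (auto simp: C_def)
qed

theorem theorem2p2:
  fixes X :: "'a topology"
  assumes "Hausdorff_space X"
    and "first_countable X"
    and "almost_regular_space X"
    and "two_wins_G1 omega1 (open_covers X) (dense_open_families X)"
  shows "|topspace X| \<le>o ctwo ^c natLeq"
proof -
  let ?O = "open_covers X"
  have wo: "Well_order omega1"
    using Card_order_omega1 by (simp add: card_order_on_def)
  obtain \<sigma> where strat: "strategy_two omega1 ?O \<sigma>"
    and win: "\<And>U. (\<forall>\<beta>\<in>Field omega1. U \<beta> \<in> ?O)
      \<Longrightarrow> {response omega1 \<sigma> U \<beta> |\<beta>. \<beta> \<in> Field omega1} \<in> dense_open_families X"
    using assms(4) unfolding two_wins_G1_def winning_strategy_two_def by blast
  obtain B :: "'a \<Rightarrow> nat \<Rightarrow> 'a set"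
    where B_op: "\<And>x n. x \<in> topspace X \<Longrightarrow> openin X (B x n)"
      and B_mem: "\<And>x n. x \<in> topspace X \<Longrightarrow> x \<in> B x n"
      and B_base: "\<And>x U. x \<in> topspace X \<Longrightarrow> openin X U \<Longrightarrow> x \<in> U \<Longrightarrow> \<exists>n. B x n \<subseteq> U"
    by (rule first_countable_decseq_base[OF assms(2)]) (rule that)

  let ?legal = "\<lambda>\<beta> p. \<beta> \<in> Field omega1 \<and> (\<forall>\<gamma>\<in>underS omega1 \<beta>. p \<gamma> \<in> ?O)"
  have "\<exists>x N. (\<forall>n. N n \<in> ?O) \<and> (?legal \<beta> p \<longrightarrow> x \<in> topspace X
      \<and> (\<forall>n. response omega1 \<sigma> (p(\<beta> := N n)) \<beta> = B x n))" for \<beta> p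
  proof (cases "?legal \<beta> p")
    case True
    then obtain x where x: "x \<in> topspace X"
      and ans: "\<And>W. openin X W \<Longrightarrow> x \<in> W
        \<Longrightarrow> \<exists>C\<in>?O. response omega1 \<sigma> (p(\<beta> := C)) \<beta> = W"
      using exists_point_all_neighbourhoods_answered[OF strat, of \<beta> p] by blast
    have "\<forall>n. \<exists>C. C \<in> ?O \<and> response omega1 \<sigma> (p(\<beta> := C)) \<beta> = B x n"
      using ans B_op[OF x] B_mem[OF x] by blast
    then show ?thesis
      using x by metis
  next
    case False
    \<comment> \<open>Offering a genuine cover even here makes every branch of the tree a legal play.\<close>
    have "{topspace X} \<in> ?O"
      by (simp add: open_covers_def)
    then show ?thesis
      using False by (intro exI[of _ undefined] exI[of _ "\<lambda>_. {topspace X}"]) auto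
  qed
  then obtain x N where N: "\<And>\<beta> p n. N \<beta> p n \<in> ?O"
    and x: "\<And>\<beta> p. ?legal \<beta> p \<Longrightarrow> x \<beta> p \<in> topspace X"
    and ans: "\<And>\<beta> p n. ?legal \<beta> p
      \<Longrightarrow> response omega1 \<sigma> (p(\<beta> := N \<beta> p n)) \<beta> = B (x \<beta> p) n"
    by metis

  define D where "D = (\<Union>\<beta>\<in>Field omega1. x \<beta> ` tree_level omega1 N \<beta>)"
  have D_top: "D \<subseteq> topspace X"
    unfolding D_def by (auto simp: tree_level_def N intro!: x)
  have "|x \<beta> ` tree_level omega1 N \<beta>| \<le>o ctwo ^c natLeq" if "\<beta> \<in> Field omega1" for \<beta>
    using card_of_image card_tree_level[OF wo countable_underS_omega1[OF that]] ordLeq_transitive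
    by blast
  then have card_D: "|D| \<le>o ctwo ^c natLeq"
    unfolding D_def
    by (intro card_of_UNION_ordLeq_infinite_Field Card_order_cexp card_Field_omega1 ballI)
      (use cinfinite_cexp[OF ordLeq_refl[OF Card_order_ctwo] natLeq_Cinfinite]
        in \<open>auto simp: cinfinite_def\<close>)

  have "X closure_of D = topspace X"
  proof (rule ccontr)
    assume "X closure_of D \<noteq> topspace X"
    then have "topspace X - X closure_of D \<noteq> {}"
      using closure_of_subset_topspace[of X D] by blast
    moreover have "openin X (topspace X - X closure_of D)"
      by (simp add: openin_diff)
    ultimately obtain V where V: "openin X V" "V \<noteq> {}"
      and cl_V: "X closure_of V \<subseteq> topspace X - X closure_of D"
      using assms(3) unfolding almost_regular_space_def by metis
    have miss: "\<exists>n. B y n \<inter> V = {}" if "y \<in> D" for y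
    proof -
      have "y \<in> topspace X"
        using D_top that by blast
      moreover have "y \<in> X closure_of D"
        using closure_of_subset[OF D_top] that by blast
      ultimately obtain n where "B y n \<subseteq> topspace X - X closure_of V"
        using B_base[of y "topspace X - X closure_of V"] cl_V by (auto simp: openin_diff)
      then show ?thesis
        using closure_of_subset[OF openin_subset[OF V(1)]] by blast
    qed
    \<comment> \<open>Player one always picks the cover that is answered by a basic set disjoint from \<open>V\<close>.\<close>
    obtain P where P: "\<And>\<beta>. P \<beta> = N \<beta> (restrict P (underS omega1 \<beta>))
        (SOME n. B (x \<beta> (restrict P (underS omega1 \<beta>))) n \<inter> V = {})"
      by (rule history_recursion[OF wo, where
            G = "\<lambda>\<beta> p. N \<beta> p (SOME n. B (x \<beta> p) n \<inter> V = {})"]) blast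
    have P_cover: "P \<beta> \<in> ?O" for \<beta>
      using P[of \<beta>] N by simp
    have misses_V: "response omega1 \<sigma> P \<beta> \<inter> V = {}" if \<beta>: "\<beta> \<in> Field omega1" for \<beta>
    proof -
      define p where "p = restrict P (underS omega1 \<beta>)"
      define n where "n = (SOME n. B (x \<beta> p) n \<inter> V = {})"
      have "p \<in> tree_level omega1 N \<beta>"
        unfolding tree_level_def p_def
        by (intro CollectI exI[of _ P] conjI refl
            exI[of _ "\<lambda>\<gamma>. SOME n. B (x \<gamma> (restrict P (underS omega1 \<gamma>))) n \<inter> V = {}"]
            ballI P)
      then have "\<exists>n. B (x \<beta> p) n \<inter> V = {}"
        using \<beta> by (intro miss) (auto simp: D_def)
      then have "B (x \<beta> p) n \<inter> V = {}"
        unfolding n_def by (rule someI_ex)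
      moreover have "response omega1 \<sigma> P \<beta> = response omega1 \<sigma> (p(\<beta> := N \<beta> p n)) \<beta>"
        using P[of \<beta>] by (intro response_cong) (auto simp: p_def n_def under_def underS_def)
      moreover have "?legal \<beta> p"
        using \<beta> P_cover by (simp add: p_def)
      ultimately show ?thesis
        using ans by simp
    qed
    obtain v where v: "v \<in> V"
      using V(2) by blast
    have "X closure_of (\<Union>{response omega1 \<sigma> P \<beta> |\<beta>. \<beta> \<in> Field omega1}) = topspace X"
      using win[of P] P_cover by (simp add: dense_open_families_def)
    then have "v \<in> X closure_of (\<Union>{response omega1 \<sigma> P \<beta> |\<beta>. \<beta> \<in> Field omega1})"
      using v openin_subset[OF V(1)] by blast
    then have "\<exists>y. y \<in> \<Union>{response omega1 \<sigma> P \<beta> |\<beta>. \<beta> \<in> Field omega1} \<and> y \<in> V"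
      using v V(1) unfolding in_closure_of by blast
    then show False
      using misses_V by blast
  qed
  then show ?thesis
    using card_closure_of[OF assms(1,2) card_D] by simp
qed

end
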